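(* Let $\mathbb{X}, \mathbb{Y}, \mathbb{Z}$ be finite-dimensional real Banach spaces, each of dimension strictly greater than $1$. Let $\mathcal{T}, \mathcal{A} \in \mathscr{B}(\mathbb{X} \times \mathbb{Y}, \mathbb{Z})$ be bounded bilinear operators. Then $\mathcal{T} \perp_B \mathcal{A}$ if and only if there exist $(x_1,y_1), (x_2,y_2) \in M_{\mathcal{T}}$ such that $\mathcal{A}(x_1,y_1) \in \mathcal{T}(x_1,y_1)^{+}$ and $\mathcal{A}(x_2,y_2) \in \mathcal{T}(x_2,y_2)^{-}$.
   Context: The product $\mathbb{X} \times \mathbb{Y}$ carries the norm $\|(x,y)\| = \max\{\|x\|,\|y\|\}$, and $S_{\mathbb{X} \times \mathbb{Y}}$ is its unit sphere. For a bilinear operator $\mathcal{T}: \mathbb{X} \times \mathbb{Y} \to \mathbb{Z}$ (linear in each argument), $\|\mathcal{T}\| = \sup\{\|\mathcal{T}(x,y)\| : (x,y) \in S_{\mathbb{X} \times \mathbb{Y}}\}$; $\mathcal{T}$ is bounded if $\|\mathcal{T}\|<\infty$. $\mathscr{B}(\mathbb{X} \times \mathbb{Y}, \mathbb{Z})$ is the Banach space of all bounded bilinear operators with this norm. The norm attainment set is $M_{\mathcal{T}} = \{(x,y) \in S_{\mathbb{X} \times \mathbb{Y}} : \|\mathcal{T}(x,y)\| = \|\mathcal{T}\|\}$. In a real Banach space $E$, for $u, v \in E$, Birkhoff-James orthogonality $u \perp_B v$ means $\|u + \lambda v\| \geq \|u\|$ for all $\lambda \in \mathbb{R}$. For $u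 \in E$: $u^{+} = \{v \in E : \|u + \lambda v\| \geq \|u\| \text{ for all } \lambda \geq 0\}$ and $u^{-} = \{v \in E : \|u + \lambda v\| \geq \|u\| \text{ for all } \lambda \leq 0\}$. *)

theory Defs
  imports "HOL-Analysis.Analysis"
begin

definition finite_dim :: "'a::real_vector set \<Rightarrow> bool" where
  "finite_dim V \<longleftrightarrow> (\<exists>B. finite B \<and> span B = V)"

text \<open>The library norm on \<open>'a \<times> 'b\<close> is the Euclidean combination of the two norms, so the unit
  sphere for the maximum norm is written out explicitly.\<close>

definition prod_sphere :: "('a::real_normed_vector \<times> 'b::real_normed_vector) set" where
  "prod_sphere = {(x, y). max (norm x) (norm y) = 1}"

text \<open>Bilinear operators are curried functions, as in the library predicate \<open>bounded_bilinear\<close>.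
  The supremum below is taken in the reals, so it is meaningful only if the set of values is
  nonempty and bounded above. It is nonempty as soon as one of the factors is nontrivial; for
  bilinear operators, its boundedness is equivalent to \<open>bounded_bilinear\<close>
  (lemma \<open>bounded_bilinear_iff_bdd_above\<close>).\<close>

definition bilinear_norm ::
  "('a::real_normed_vector \<Rightarrow> 'b::real_normed_vector \<Rightarrow> 'c::real_normed_vector) \<Rightarrow> real" where
  "bilinear_norm T = (SUP (x, y) \<in> prod_sphere. norm (T x y))"

definition norm_attainment_set ::
  "('a::real_normed_vector \<Rightarrow> 'b::real_normed_vector \<Rightarrow> 'c::real_normed_vector) \<Rightarrow> ('a \<times> 'b) set" where
  "norm_attainment_set T = {(x, y) \<in> prod_sphere. norm (T x y) = bilinear_norm T}"

text \<open>Birkhoff--James orthogonality in the normed space of bounded bilinear operators, whose vector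
  space operations are pointwise.\<close>

definition bilinear_bj_orthogonal ::
  "('a::real_normed_vector \<Rightarrow> 'b::real_normed_vector \<Rightarrow> 'c::real_normed_vector)
    \<Rightarrow> ('a \<Rightarrow> 'b \<Rightarrow> 'c) \<Rightarrow> bool" where
  "bilinear_bj_orthogonal T A \<longleftrightarrow>
    (\<forall>l::real. bilinear_norm (\<lambda>x y. T x y + l *\<^sub>R A x y) \<ge> bilinear_norm T)"

definition bj_plus :: "'a::real_normed_vector \<Rightarrow> 'a set" where
  "bj_plus u = {v. \<forall>l::real. l \<ge> 0 \<longrightarrow> norm (u + l *\<^sub>R v) \<ge> norm u}"

definition bj_minus :: "'a::real_normed_vector \<Rightarrow> 'a set" where
  "bj_minus u = {v. \<forall>l::real. l \<le> 0 \<longrightarrow> norm (u + l *\<^sub>R v) \<ge> norm u}"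

lemma bounded_bilinear_iff_bdd_above:
  fixes T :: "'a::real_normed_vector \<Rightarrow> 'b::real_normed_vector \<Rightarrow> 'c::real_normed_vector"
  shows "bounded_bilinear T \<longleftrightarrow>
    bilinear T \<and> bdd_above ((\<lambda>(x, y). norm (T x y)) ` prod_sphere)"
proof
  assume T: "bounded_bilinear T"
  then interpret bounded_bilinear T .
  obtain K where K: "K > 0" "\<And>x y. norm (T x y) \<le> norm x * norm y * K"
    using pos_bounded by blast
  have "norm (T x y) \<le> K" if "(x, y) \<in> prod_sphere" for x y
  proof -
    have "norm x \<le> 1" "norm y \<le> 1"
      using that by (auto simp: prod_sphere_def)
    then have "norm x * norm y * K \<le> 1 * 1 * K"
      using K(1) by (intro mult_mono) auto
    then show ?thesis
      using K(2)[of x y] by simp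
  qed
  then have "bdd_above ((\<lambda>(x, y). norm (T x y)) ` prod_sphere)"
    by (intro bdd_aboveI[of _ K]) auto
  then show "bilinear T \<and> bdd_above ((\<lambda>(x, y). norm (T x y)) ` prod_sphere)"
    by (auto simp: bilinear_def add_left add_right scaleR_left scaleR_right intro!: linearI)
next
  assume R: "bilinear T \<and> bdd_above ((\<lambda>(x, y). norm (T x y)) ` prod_sphere)"
  then have b: "bilinear T" by simp
  obtain K where K: "\<And>x y. (x, y) \<in> prod_sphere \<Longrightarrow> norm (T x y) \<le> K"
    using R by (fastforce simp: bdd_above_def)
  show "bounded_bilinear T"
  proof
    show "\<exists>K. \<forall>x y. norm (T x y) \<le> norm x * norm y * K"
    proof (intro exI allI)
      fix x y
      show "norm (T x y) \<le> norm x * norm y * K"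
      proof (cases "x = 0 \<or> y = 0")
        case True
        then show ?thesis
          using b by (auto simp: bilinear_lzero bilinear_rzero)
      next
        case False
        have "T x y = T (norm x *\<^sub>R sgn x) (norm y *\<^sub>R sgn y)"
          using False by (simp add: sgn_div_norm)
        also have "\<dots> = (norm x * norm y) *\<^sub>R T (sgn x) (sgn y)"
          using b by (simp add: bilinear_lmul bilinear_rmul)
        finally have "norm (T x y) = norm x * norm y * norm (T (sgn x) (sgn y))"
          by (simp add: abs_mult)
        moreover have "norm (T (sgn x) (sgn y)) \<le> K"
          using False by (intro K) (simp add: prod_sphere_def norm_sgn)
        ultimately show ?thesis
          by (simp add: mult_left_mono)
      qed
    qed
  qed (use b in \<open>auto simp: bilinear_ladd bilinear_radd bilinear_lmul bilinear_rmul\<close>)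
qed

end

theory Submission
  imports Defs
begin

text \<open>For the nontrivial direction, perturb \<open>T\<close> by \<open>A / n\<close>: by orthogonality some point \<open>p\<^sub>n\<close> of the
  compact unit sphere satisfies \<open>\<parallel>(T + A / n) p\<^sub>n\<parallel> \<ge> \<parallel>T\<parallel>\<close>. Since \<open>l \<mapsto> \<parallel>(T + l A) p\<^sub>n\<parallel>\<close> is convex
  and at most \<open>\<parallel>T\<parallel>\<close> at \<open>0\<close>, it stays at least \<open>\<parallel>T\<parallel>\<close> for all \<open>l \<ge> 1 / n\<close>. A limit point
  \<open>p\<close> of the \<open>p\<^sub>n\<close> therefore attains the norm of \<open>T\<close> and satisfies \<open>A p \<in> (T p)\<^sup>+\<close>; the minus cone is
  reached by replacing \<open>A\<close> with \<open>-A\<close>.\<close>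

text \<open>Induction on the generators. A new \<open>b\<close> outside \<open>span B\<close> has
  positive distance \<open>e\<close> from \<open>span B\<close>, so a vector of norm at most
  \<open>r\<close> has a \<open>b\<close>-coefficient of size at most \<open>r / e\<close>. The
  remainder in \<open>span B\<close> is then bounded as well, though by a larger radius, which is
  why \<open>r\<close> is arbitrary in the induction.\<close>

lemma compact_span_Int_cball:
  fixes B :: "'a::real_normed_vector set"
  assumes "finite B"
  shows "compact (span B \<inter> cball 0 r)"
  using assms
proof (induction B arbitrary: r rule: finite_induct)
  case empty
  show ?case by (auto intro: finite_imp_compact)
next
  case (insert b B)
  show ?case
  proof (cases "b \<in> span B")
    case True
    then show ?thesis using insert.IH by (simp add: span_redundant)
  next
    case False
    \<comment> \<open>The induction hypothesis makes only bounded pieces of \<open>span B\<close>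
      closed. Radius \<open>norm b + 1\<close> suffices: every point of \<open>span B\<close> within
      distance 1 of \<open>b\<close> lies in that ball, hence the cap at 1 in
      \<open>e\<close>.\<close>
    have "open (- (span B \<inter> cball 0 (norm b + 1)))"
      by (intro open_Compl compact_imp_closed insert.IH)
    with False obtain e0 where e0: "e0 > 0" "ball b e0 \<subseteq> - (span B \<inter> cball 0 (norm b + 1))"
      by (meson ComplI IntD1 openE)
    define e where "e = min e0 1"
    have e: "e > 0" using e0(1) by (simp add: e_def)
    have far: "norm (b + v) \<ge> e" if "v \<in> span B" for v
    proof (rule ccontr)
      assume "\<not> norm (b + v) \<ge> e"
      then have less: "norm (b + v) < e0" "norm (b + v) < 1" by (auto simp: e_def)
      have "- v \<in> ball b e0" using less(1) by (simp add: dist_norm)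
      moreover have "norm v \<le> norm b + 1"
        using norm_triangle_ineq4[of "b + v" b] less(2) by simp
      ultimately show False using e0(2) that by (auto simp: span_neg)
    qed
    \<comment> \<open>\<open>R\<close> bounds \<open>x - c *\<^sub>R b\<close> when
      \<open>norm x\<close> is at most \<open>r\<close> and \<open>\<bar>c\<bar>\<close> at most
      \<open>r / e\<close>. The compact image \<open>K\<close> may leave the ball of radius
      \<open>r\<close>, so it is cut back to it below.\<close>
    define R where "R = r + r / e * norm b"
    define K where
      "K = (\<lambda>p. fst p *\<^sub>R b + snd p) ` ({- (r / e)..r / e} \<times> (span B \<inter> cball 0 R))"
    have "compact K"
      unfolding K_def
      by (intro compact_continuous_image continuous_intros compact_Times insert.IH) simp
    moreover have "span (insert b B) \<inter> cball 0 r = K \<inter> cball 0 r"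
    proof (intro equalityI subsetI)
      fix x assume x: "x \<in> span (insert b B) \<inter> cball 0 r"
      then obtain c where c: "x - c *\<^sub>R b \<in> span B" by (auto simp: span_insert)
      have "\<bar>c\<bar> * e \<le> norm x"
      proof (cases "c = 0")
        case False
        have "\<bar>c\<bar> * e \<le> \<bar>c\<bar> * norm (b + (1 / c) *\<^sub>R (x - c *\<^sub>R b))"
          by (intro mult_left_mono far span_scale c) simp
        also have "\<dots> = norm (c *\<^sub>R (b + (1 / c) *\<^sub>R (x - c *\<^sub>R b)))" by simp
        also have "c *\<^sub>R (b + (1 / c) *\<^sub>R (x - c *\<^sub>R b)) = x"
          using False by (simp add: algebra_simps)
        finally show ?thesis .
      qed simp
      then have abs_c: "\<bar>c\<bar> \<le> r / e" using x e by (simp add: field_simps)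
      have "norm (x - c *\<^sub>R b) \<le> norm x + \<bar>c\<bar> * norm b"
        using norm_triangle_ineq4[of x "c *\<^sub>R b"] by simp
      also have "\<dots> \<le> R"
        unfolding R_def using x abs_c by (intro add_mono mult_right_mono) auto
      finally have "(c, x - c *\<^sub>R b) \<in> {- (r / e)..r / e} \<times> (span B \<inter> cball 0 R)"
        using c abs_c by auto
      then have "x \<in> K" unfolding K_def by (rule rev_image_eqI) simp
      then show "x \<in> K \<inter> cball 0 r" using x by simp
    next
      fix x assume "x \<in> K \<inter> cball 0 r"
      then show "x \<in> span (insert b B) \<inter> cball 0 r"
        by (auto simp: K_def span_insert) (metis add_diff_cancel_left')
    qed
    ultimately show ?thesis by (simp add: compact_Int_closed)
  qed
qed

lemma finite_dim_imp_compact_cball: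
  assumes "finite_dim (UNIV :: 'a::real_normed_vector set)"
  shows "compact (cball (0::'a) r)"
  using assms compact_span_Int_cball unfolding finite_dim_def by (metis Int_UNIV_left)

lemma compact_prod_sphere:
  assumes "finite_dim (UNIV :: 'a::real_normed_vector set)"
    and "finite_dim (UNIV :: 'b::real_normed_vector set)"
  shows "compact (prod_sphere :: ('a \<times> 'b) set)"
proof -
  have "closed {p :: 'a \<times> 'b. max (norm (fst p)) (norm (snd p)) = 1}"
    by (intro closed_Collect_eq continuous_intros)
  then have "compact ((cball (0::'a) 1 \<times> cball (0::'b) 1)
      \<inter> {p. max (norm (fst p)) (norm (snd p)) = 1})"
    using assms by (intro compact_Int_closed compact_Times finite_dim_imp_compact_cball)
  also have "(cball (0::'a) 1 \<times> cball (0::'b) 1)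
      \<inter> {p. max (norm (fst p)) (norm (snd p)) = 1} = prod_sphere"
    by (auto simp: prod_sphere_def)
  finally show ?thesis .
qed

text \<open>By convexity: \<open>u + s *\<^sub>R v\<close> lies on the segment from \<open>u\<close>
  to \<open>u + l *\<^sub>R v\<close>, with weight \<open>s / l\<close> on the far end. Were the
  norm at the far end below \<open>M\<close>, it would be below \<open>M\<close> at \<open>s\<close>
  too.\<close>

lemma norm_ge_extrapolate:
  fixes u v :: "'a::real_normed_vector"
  assumes "norm u \<le> M" "norm (u + s *\<^sub>R v) \<ge> M" "0 < s" "s \<le> l"
  shows "norm (u + l *\<^sub>R v) \<ge> M"
proof -
  define t where "t = s / l"
  have t: "0 < t" "t \<le> 1" "t * l = s" using assms(3,4) by (auto simp: t_def)
  have "u + s *\<^sub>R v = (1 - t) *\<^sub>R u + t *\<^sub>R (u + l *\<^sub>R v)"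
    by (simp add: algebra_simps flip: t(3))
  then have "M \<le> norm ((1 - t) *\<^sub>R u + t *\<^sub>R (u + l *\<^sub>R v))" using assms(2) by simp
  also have "\<dots> \<le> (1 - t) * norm u + t * norm (u + l *\<^sub>R v)"
    using norm_triangle_ineq[of "(1 - t) *\<^sub>R u" "t *\<^sub>R (u + l *\<^sub>R v)"] t by simp
  also have "\<dots> \<le> (1 - t) * M + t * norm (u + l *\<^sub>R v)"
    using t assms(1) by (intro add_mono mult_left_mono) auto
  finally have "t * M \<le> t * norm (u + l *\<^sub>R v)" by (simp add: algebra_simps)
  then show ?thesis using t(1) by simp
qed

text \<open>The limit argument for arbitrary continuous maps on a compact set; \<open>f\<close>,
  \<open>g\<close> and \<open>M\<close> stand for \<open>T\<close>, \<open>A\<close> and the norm of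
  \<open>T\<close>. The point in \<open>ge\<close> may depend on \<open>l\<close>, whereas the one
  obtained serves all \<open>l\<close> at once.\<close>

lemma compact_attains_bj_plus:
  fixes f g :: "'a::metric_space \<Rightarrow> 'b::real_normed_vector"
  assumes K: "compact K" and f: "continuous_on K f" and g: "continuous_on K g"
    and le: "\<And>p. p \<in> K \<Longrightarrow> norm (f p) \<le> M"
    and ge: "\<And>l. l > 0 \<Longrightarrow> \<exists>p\<in>K. norm (f p + l *\<^sub>R g p) \<ge> M"
  shows "\<exists>p\<in>K. norm (f p) = M \<and> g p \<in> bj_plus (f p)"
proof -
  have "\<exists>p\<in>K. norm (f p + inverse (real (Suc n)) *\<^sub>R g p) \<ge> M" for n
    by (rule ge) simp
  then obtain p where p: "\<And>n. p n \<in> K"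
      "\<And>n. norm (f (p n) + inverse (real (Suc n)) *\<^sub>R g (p n)) \<ge> M"
    by metis
  obtain q r where q: "q \<in> K" "strict_mono r" "(p \<circ> r) \<longlonglongrightarrow> q"
    using K p(1) unfolding compact_def by metis
  have fq: "(\<lambda>n. f (p (r n))) \<longlonglongrightarrow> f q" and gq: "(\<lambda>n. g (p (r n))) \<longlonglongrightarrow> g q"
    using q p(1) f g by (auto simp: continuous_on_sequentially o_def)
  have inv: "(\<lambda>n. inverse (real (Suc (r n)))) \<longlonglongrightarrow> 0"
    using LIMSEQ_subseq_LIMSEQ[OF LIMSEQ_inverse_real_of_nat q(2)] by (simp add: o_def)
  \<comment> \<open>Here \<open>l\<close> stays fixed while \<open>n\<close> grows: eventually the
    step \<open>inverse (real (Suc (r n)))\<close> is below \<open>l\<close>, so the bound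
    extrapolates from that step to \<open>l\<close> and survives the limit.\<close>
  have pos: "norm (f q + l *\<^sub>R g q) \<ge> M" if "l > 0" for l
  proof (rule tendsto_lowerbound)
    show "(\<lambda>n. norm (f (p (r n)) + l *\<^sub>R g (p (r n)))) \<longlonglongrightarrow> norm (f q + l *\<^sub>R g q)"
      by (intro tendsto_intros fq gq)
    show "\<forall>\<^sub>F n in sequentially. M \<le> norm (f (p (r n)) + l *\<^sub>R g (p (r n)))"
      using order_tendstoD(2)[OF inv that]
      by eventually_elim
        (rule norm_ge_extrapolate[OF le[OF p(1)] p(2)], auto)
  qed simp
  \<comment> \<open>Letting \<open>l\<close> tend to 0 from the right gives the value at 0, which
    \<open>pos\<close> does not cover.\<close>
  have "norm (f q) \<ge> M"
  proof (rule tendsto_lowerbound)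
    show "((\<lambda>l. norm (f q + l *\<^sub>R g q)) \<longlongrightarrow> norm (f q)) (at_right 0)"
      by (auto intro!: tendsto_eq_intros)
    show "\<forall>\<^sub>F l in at_right 0. M \<le> norm (f q + l *\<^sub>R g q)"
      using pos by (auto simp: eventually_at_filter)
  qed simp
  then have "norm (f q) = M" using le[OF q(1)] by simp
  moreover have "norm (f q + l *\<^sub>R g q) \<ge> norm (f q)" if "l \<ge> 0" for l
    using pos[of l] that calculation by (cases "l = 0") auto
  ultimately show ?thesis using q(1) by (auto simp: bj_plus_def)
qed

lemma uminus_mem_bj_plus_iff: "- v \<in> bj_plus u \<longleftrightarrow> v \<in> bj_minus u"
proof -
  have "(\<forall>l\<ge>0. norm u \<le> norm (u - l *\<^sub>R v)) \<longleftrightarrow> (\<forall>l\<le>0. norm u \<le> norm (u + l *\<^sub>R v))"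
    by (metis add.inverse_inverse diff_conv_add_uminus neg_0_le_iff_le scaleR_minus_left)
  then show ?thesis by (simp add: bj_plus_def bj_minus_def)
qed

text \<open>A real \<open>SUP\<close> dominates its members once they are bounded above, which
  \<open>bounded_bilinear_iff_bdd_above\<close> provides.\<close>

lemma norm_le_bilinear_norm:
  assumes "bounded_bilinear T" "(x, y) \<in> prod_sphere"
  shows "norm (T x y) \<le> bilinear_norm T"
  using assms unfolding bilinear_norm_def bounded_bilinear_iff_bdd_above
  by (auto intro: cSUP_upper2[where x = "(x, y)"])

lemma bounded_bilinear_lincomb:
  assumes "bounded_bilinear T" "bounded_bilinear A"
  shows "bounded_bilinear (\<lambda>x y. a *\<^sub>R T x y + b *\<^sub>R A x y)"
proof -
  interpret T: bounded_bilinear T by fact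
  interpret A: bounded_bilinear A by fact
  obtain K L where K: "\<And>x y. norm (T x y) \<le> norm x * norm y * K"
    and L: "\<And>x y. norm (A x y) \<le> norm x * norm y * L"
    using T.bounded A.bounded by blast
  show ?thesis
  proof
    have "norm (a *\<^sub>R T x y + b *\<^sub>R A x y) \<le> norm x * norm y * (\<bar>a\<bar> * K + \<bar>b\<bar> * L)" for x y
    proof -
      have "norm (a *\<^sub>R T x y + b *\<^sub>R A x y) \<le> \<bar>a\<bar> * norm (T x y) + \<bar>b\<bar> * norm (A x y)"
        using norm_triangle_ineq[of "a *\<^sub>R T x y" "b *\<^sub>R A x y"] by simp
      also have "\<dots> \<le> \<bar>a\<bar> * (norm x * norm y * K) + \<bar>b\<bar> * (norm x * norm y * L)"
        by (intro add_mono mult_left_mono K L) auto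
      finally show ?thesis by (simp add: algebra_simps)
    qed
    then show "\<exists>K. \<forall>x y. norm (a *\<^sub>R T x y + b *\<^sub>R A x y) \<le> norm x * norm y * K" by blast
  qed (simp_all add: T.add_left T.add_right T.scaleR_left T.scaleR_right
      A.add_left A.add_right A.scaleR_left A.scaleR_right algebra_simps)
qed

lemma bounded_bilinear_add_scaleR:
  assumes "bounded_bilinear T" "bounded_bilinear A"
  shows "bounded_bilinear (\<lambda>x y. T x y + l *\<^sub>R A x y)"
  using bounded_bilinear_lincomb[OF assms, of 1 l] by simp

lemma bounded_bilinear_uminus:
  assumes "bounded_bilinear A"
  shows "bounded_bilinear (\<lambda>x y. - A x y)"
  using bounded_bilinear_lincomb[OF assms assms, of 0 "- 1"] by simp

text \<open>Compactness turns the supremum into a maximum, so that inequalities between operator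
  norms can be read off at a point.\<close>

lemma bilinear_norm_attained:
  fixes T :: "'a::real_normed_vector \<Rightarrow> 'b::real_normed_vector \<Rightarrow> 'c::real_normed_vector"
  assumes "bounded_bilinear T"
    and "compact (prod_sphere :: ('a \<times> 'b) set)" "(prod_sphere :: ('a \<times> 'b) set) \<noteq> {}"
  obtains x y where "(x, y) \<in> norm_attainment_set T"
proof -
  have "continuous_on prod_sphere (\<lambda>p :: 'a \<times> 'b. norm (T (fst p) (snd p)))"
    by (intro continuous_intros bounded_bilinear.continuous_on[OF assms(1)])
  from continuous_attains_sup[OF assms(2,3) this] obtain p
    where p: "p \<in> prod_sphere"
      "\<And>q. q \<in> prod_sphere \<Longrightarrow> norm (T (fst q) (snd q)) \<le> norm (T (fst p) (snd p))"
    by auto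
  have "bilinear_norm T \<le> norm (T (fst p) (snd p))"
    unfolding bilinear_norm_def using p(2) by (intro cSUP_least assms(3)) (auto simp: case_prod_beta)
  with norm_le_bilinear_norm[OF assms(1), of "fst p" "snd p"] p(1)
  have "(fst p, snd p) \<in> norm_attainment_set T" by (auto simp: norm_attainment_set_def)
  then show ?thesis by (rule that)
qed

text \<open>Assuming the inequality for positive \<open>l\<close> only makes this one-sided form
  applicable to both \<open>A\<close> and \<open>- A\<close>.\<close>

lemma exists_norm_attained_bj_plus:
  fixes T :: "'a::real_normed_vector \<Rightarrow> 'b::real_normed_vector \<Rightarrow> 'c::real_normed_vector"
  assumes T: "bounded_bilinear T" and A: "bounded_bilinear A"
    and K: "compact (prod_sphere :: ('a \<times> 'b) set)" "(prod_sphere :: ('a \<times> 'b) set) \<noteq> {}"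
    and orth: "\<And>l. l > 0 \<Longrightarrow> bilinear_norm (\<lambda>x y. T x y + l *\<^sub>R A x y) \<ge> bilinear_norm T"
  shows "\<exists>x y. (x, y) \<in> norm_attainment_set T \<and> A x y \<in> bj_plus (T x y)"
proof -
  have "\<exists>p\<in>prod_sphere. norm (T (fst p) (snd p)) = bilinear_norm T
      \<and> A (fst p) (snd p) \<in> bj_plus (T (fst p) (snd p))"
  proof (rule compact_attains_bj_plus[OF K(1)])
    fix l :: real assume "l > 0"
    obtain x y where "(x, y) \<in> norm_attainment_set (\<lambda>x y. T x y + l *\<^sub>R A x y)"
      using bilinear_norm_attained[OF bounded_bilinear_add_scaleR[OF T A] K] by blast
    with orth[OF \<open>l > 0\<close>]
    show "\<exists>p\<in>prod_sphere. norm (T (fst p) (snd p) + l *\<^sub>R A (fst p) (snd p)) \<ge> bilinear_norm T"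
      by (auto simp: norm_attainment_set_def intro!: bexI[of _ "(x, y)"])
  qed (auto intro!: bounded_bilinear.continuous_on[OF T] bounded_bilinear.continuous_on[OF A]
      continuous_intros norm_le_bilinear_norm[OF T])
  then show ?thesis unfolding norm_attainment_set_def by fastforce
qed

text \<open>A space containing only 0 has the empty set as a basis, hence dimension 0; otherwise a
  normalized vector paired with 0 has maximum norm 1.\<close>

lemma prod_sphere_nonempty:
  assumes "dim (UNIV :: 'a::real_normed_vector set) > 0"
  shows "(prod_sphere :: ('a \<times> 'b::real_normed_vector) set) \<noteq> {}"
proof -
  obtain x :: 'a where "x \<noteq> 0"
  proof -
    have "dim (UNIV :: 'a set) = card ({} :: 'a set)" if "\<And>x :: 'a. x = 0"
      using that by (intro real_vector.dim_eq_card) (auto simp: real_vector.independent_empty)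
    with assms that show ?thesis by fastforce
  qed
  then have "(sgn x, 0) \<in> prod_sphere" by (simp add: prod_sphere_def norm_sgn)
  then show ?thesis by blast
qed

theorem theorem2p4:
  fixes T A :: "'x::banach \<Rightarrow> 'y::banach \<Rightarrow> 'z::banach"
  assumes "finite_dim (UNIV :: 'x set)" and "dim (UNIV :: 'x set) > 1"
    and "finite_dim (UNIV :: 'y set)" and "dim (UNIV :: 'y set) > 1"
    and "finite_dim (UNIV :: 'z set)" and "dim (UNIV :: 'z set) > 1"
    and "bounded_bilinear T" and "bounded_bilinear A"
  shows "bilinear_bj_orthogonal T A \<longleftrightarrow>
    (\<exists>x1 y1 x2 y2. (x1, y1) \<in> norm_attainment_set T \<and> (x2, y2) \<in> norm_attainment_set T \<and>
      A x1 y1 \<in> bj_plus (T x1 y1) \<and> A x2 y2 \<in> bj_minus (T x2 y2))"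
    (is "_ \<longleftrightarrow> ?R")
proof
  note K = compact_prod_sphere[OF assms(1,3)]
    prod_sphere_nonempty[OF less_trans[OF zero_less_one assms(2)], where 'b = 'y]
  assume orth: "bilinear_bj_orthogonal T A"
  have "\<exists>x y. (x, y) \<in> norm_attainment_set T \<and> A x y \<in> bj_plus (T x y)"
    using orth by (intro exists_norm_attained_bj_plus[OF assms(7,8) K])
      (simp add: bilinear_bj_orthogonal_def)
  \<comment> \<open>Orthogonality at \<open>- l\<close> is the one-sided condition for
    \<open>- A\<close> at \<open>l\<close>; the sign change in the cone then yields
    \<open>bj_minus\<close>.\<close>
  moreover have "\<exists>x y. (x, y) \<in> norm_attainment_set T \<and> - A x y \<in> bj_plus (T x y)"
  proof (rule exists_norm_attained_bj_plus[OF assms(7) bounded_bilinear_uminus[OF assms(8)] K])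
    fix l :: real
    show "bilinear_norm (\<lambda>x y. T x y + l *\<^sub>R - A x y) \<ge> bilinear_norm T"
      using orth[unfolded bilinear_bj_orthogonal_def, rule_format, of "- l"] by simp
  qed
  ultimately show ?R unfolding uminus_mem_bj_plus_iff by blast
next
  assume ?R
  then obtain x1 y1 x2 y2
    where 1: "(x1, y1) \<in> norm_attainment_set T" "A x1 y1 \<in> bj_plus (T x1 y1)"
      and 2: "(x2, y2) \<in> norm_attainment_set T" "A x2 y2 \<in> bj_minus (T x2 y2)"
    by blast
  show "bilinear_bj_orthogonal T A"
    unfolding bilinear_bj_orthogonal_def
  proof
    fix l :: real
    note le = norm_le_bilinear_norm[OF bounded_bilinear_add_scaleR[OF assms(7,8), of l]]
    show "bilinear_norm (\<lambda>x y. T x y + l *\<^sub>R A x y) \<ge> bilinear_norm T"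
    \<comment> \<open>The sign of \<open>l\<close> selects the point: there \<open>T\<close> attains
      its norm, the cone condition keeps the perturbed value at least as large, and
      \<open>le\<close> bounds that value by the perturbed norm.\<close>
    proof (cases "l \<ge> 0")
      case True
      then have "norm (T x1 y1) \<le> norm (T x1 y1 + l *\<^sub>R A x1 y1)"
        using 1(2) by (simp add: bj_plus_def)
      then show ?thesis using 1(1) le[of x1 y1] by (simp add: norm_attainment_set_def)
    next
      case False
      then have "norm (T x2 y2) \<le> norm (T x2 y2 + l *\<^sub>R A x2 y2)"
        using 2(2) by (simp add: bj_minus_def)
      then show ?thesis using 2(1) le[of x2 y2] by (simp add: norm_attainment_set_def)
    qed
  qed
qed

end
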